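(* For every integer $m>0$, as $N\to\infty$, $$\sum_{n=1}^N(-1)^{n+1}H_n^m=\frac{(-1)^{N+1}}{2}H_{N+1}^m+\sum_{k=0}^{m-1}\binom{m}{k}\frac{(-1)^{m-k-1}}{2}\mathcal{J}^k(m-k)+o(1).$$
   Context: $H_n=1+\frac12+\cdots+\frac1n$. For integers $k\ge0$, $\mathcal{J}^k(s)=\sum_{n\ge1}(-1)^{n+1}H_n^k n^{-s}$ ($\Re(s)>0$); $\mathcal{J}^0$ is the Dirichlet eta function. $o(1)$ denotes a quantity tending to $0$ as $N\to\infty$. *)

theory Defs
  imports "HOL-Analysis.Analysis" "HOL-Library.Landau_Symbols"
begin

(* Only meaningful for Re s > 0, where the series converges, in general only conditionally: the sum
   is the limit of the ordered partial sums. It runs over n = 1, 2, ..., hence the shift to Suc n. *)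
definition alt_harm_dirichlet :: "nat \<Rightarrow> complex \<Rightarrow> complex" where
  "alt_harm_dirichlet k s =
     (\<Sum>n. (-1) ^ (Suc n + 1) * harm (Suc n) ^ k * of_nat (Suc n) powr (- s))"

end

theory Submission
  imports Defs "HOL-Real_Asymp.Real_Asymp"
begin

text \<open>
  Summing the binomial expansion of \<open>H\<^bsub>n-1\<^esub>^m = (H\<^bsub>n\<^esub> - 1/n)^m\<close> with alternating signs over
  \<open>n = 1, \<dots>, N + 1\<close> gives minus the alternating sum up to \<open>N\<close> on the left, and the alternating sum
  up to \<open>N + 1\<close> plus partial sums of the series \<open>\<J>^k(m - k)\<close> on the right. Solving for the alternating
  sum is an exact identity, and only the convergence of the series is needed to pass to the limit.
  This follows from Leibniz' test, as \<open>H\<^bsub>n\<^esub>^k / n\<close> decreases once \<open>H\<^bsub>n\<^esub> \<ge> k\<close>.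
\<close>

text \<open>With \<open>h = harm n\<close>, the ratio of consecutive harmonic numbers is
  \<open>1 + 1 / ((n + 1) * h)\<close>. Its \<open>k\<close>-th power is at most
  \<open>exp (k / h / (n + 1))\<close>, hence at most \<open>exp (1 / (n + 1))\<close> because
  \<open>k \<le> h\<close>, and this is at most \<open>(n + 1) / n\<close>.\<close>

lemma harm_power_over_nat_Suc_le:
  assumes "n > 0" "real k \<le> harm n"
  shows "harm (Suc n) ^ k / real (Suc n) \<le> harm n ^ k / real n"
proof -
  define h where "h = (harm n :: real)"
  have h: "h > 0" "real k \<le> h"
    using assms by (auto simp: h_def harm_pos)
  have hS: "harm (Suc n) = h * (1 + 1 / (real (Suc n) * h))"
    using h(1) by (simp add: h_def [symmetric] harm_Suc inverse_eq_divide distrib_left)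
  have "(1 + 1 / (real (Suc n) * h)) ^ k \<le> exp (1 / (real (Suc n) * h)) ^ k"
    using h(1) by (intro power_mono exp_ge_add_one_self) auto
  also have "\<dots> = exp (real k / h * (1 / real (Suc n)))"
    by (simp add: exp_of_nat_mult [symmetric] field_simps)
  also have "\<dots> \<le> exp (1 / real (Suc n))"
    using h by (subst exp_le_cancel_iff, intro mult_left_le_one_le) auto
  also have "\<dots> \<le> real (Suc n) / real n"
  proof -
    \<comment> \<open>The reciprocal of the claim is \<open>1 + x \<le> exp x\<close> at
      \<open>x = - 1 / (n + 1)\<close>.\<close>
    have "real n / real (Suc n) = 1 + - (1 / real (Suc n))"
      by (simp add: field_simps)
    also have "\<dots> \<le> exp (- (1 / real (Suc n)))"
      by (rule exp_ge_add_one_self)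
    finally show ?thesis
      using assms(1) by (simp add: exp_minus field_simps)
  qed
  finally have "h ^ k * (1 + 1 / (real (Suc n) * h)) ^ k \<le> h ^ k * (real (Suc n) / real n)"
    using h(1) by (intro mult_left_mono) auto
  then show ?thesis
    using assms(1) unfolding hS h_def [symmetric] power_mult_distrib
    by (simp add: field_simps)
qed

text \<open>Eventually \<open>harm n\<close> is below \<open>ln n + euler_mascheroni + 1\<close>,
  and every fixed power of a logarithm is negligible against \<open>n\<close>.\<close>

lemma harm_power_over_nat_tendsto_0:
  "(\<lambda>n. harm n ^ k / real n) \<longlonglongrightarrow> 0"
proof -
  have "(\<lambda>n. harm n - ln (real n)) \<longlonglongrightarrow> (euler_mascheroni :: real)"
    by (rule euler_mascheroni_LIMSEQ)
  then have bnd: "eventually (\<lambda>n. harm n - ln (real n) < (euler_mascheroni :: real) + 1) sequentially"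
    by (rule order_tendstoD) simp
  have lim: "(\<lambda>n. (ln (real n) + (euler_mascheroni + 1)) ^ k / real n) \<longlonglongrightarrow> 0"
    by real_asymp
  show ?thesis
  proof (rule tendsto_sandwich [OF _ _ tendsto_const lim])
    show "eventually (\<lambda>n. harm n ^ k / real n
            \<le> (ln (real n) + (euler_mascheroni + 1)) ^ k / real n) sequentially"
      using bnd by eventually_elim (auto intro!: divide_right_mono power_mono harm_nonneg)
  qed (auto simp: harm_nonneg)
qed

text \<open>Leibniz' test applies to the tail from \<open>M\<close> on; the factor
  \<open>(-1) ^ M\<close> restores the signs that the shift may flip.\<close>

lemma summable_Leibniz_eventually:
  fixes a :: "nat \<Rightarrow> real"
  assumes "a \<longlonglongrightarrow> 0" and "\<And>n. 0 \<le> a n"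
    and "eventually (\<lambda>n. a (Suc n) \<le> a n) sequentially"
  shows "summable (\<lambda>n. (-1) ^ n * a n)"
proof -
  obtain M where M: "\<And>n. n \<ge> M \<Longrightarrow> a (Suc n) \<le> a n"
    using assms(3) by (auto simp: eventually_sequentially)
  have "summable (\<lambda>n. (-1) ^ n * a (n + M))"
    using assms M by (intro summable_Leibniz'(1) LIMSEQ_ignore_initial_segment) auto
  then have "summable (\<lambda>n. (-1) ^ M * ((-1) ^ n * a (n + M)))"
    by (rule summable_mult)
  then have "summable (\<lambda>n. (-1) ^ (n + M) * a (n + M))"
    by (simp add: power_add mult_ac)
  then show ?thesis
    by (subst (asm) summable_iff_shift)
qed

lemma summable_alternating_harm_power:
  assumes "s > 0"
  shows "summable (\<lambda>n. (-1) ^ n * (harm (Suc n) ^ k / real (Suc n) ^ s))"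
proof -
  obtain t where s: "s = Suc t"
    using assms by (cases s) auto
  \<comment> \<open>The factor \<open>b\<close> carries the eventual decrease and the limit 0;
    \<open>c\<close> is decreasing with values in [0, 1], so the product inherits both
    properties.\<close>
  define b where "b = (\<lambda>n. harm (Suc n) ^ k / real (Suc n))"
  define c where "c = (\<lambda>n. 1 / real (Suc n) ^ t)"
  have split: "harm (Suc n) ^ k / real (Suc n) ^ s = b n * c n" for n
    by (simp add: b_def c_def s)
  have b_nonneg: "b n \<ge> 0" and c_nonneg: "c n \<ge> 0" and c_le: "c n \<le> 1" for n
    by (simp_all add: b_def c_def harm_nonneg divide_le_eq)
  have b_lim: "b \<longlonglongrightarrow> 0"
    unfolding b_def by (rule LIMSEQ_Suc [OF harm_power_over_nat_tendsto_0])
  have "eventually (\<lambda>n. real k \<le> harm n) sequentially"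
    using harm_at_top by (auto simp: filterlim_at_top)
  then have "eventually (\<lambda>n. real k \<le> harm (Suc n)) sequentially"
    by (subst eventually_sequentially_Suc)
  then have "eventually (\<lambda>n. b (Suc n) * c (Suc n) \<le> b n * c n) sequentially"
  proof eventually_elim
    case (elim n)
    have "b (Suc n) \<le> b n"
      unfolding b_def by (rule harm_power_over_nat_Suc_le) (use elim in auto)
    moreover have "c (Suc n) \<le> c n"
      unfolding c_def by (intro divide_left_mono power_mono mult_pos_pos) auto
    ultimately show ?case
      using b_nonneg c_nonneg by (intro mult_mono) auto
  qed
  moreover have "(\<lambda>n. b n * c n) \<longlonglongrightarrow> 0"
    by (rule tendsto_sandwich [OF _ _ tendsto_const b_lim])
       (use b_nonneg c_nonneg c_le in \<open>auto intro!: always_eventually mult_left_le\<close>)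
  ultimately show ?thesis
    unfolding split using b_nonneg c_nonneg by (intro summable_Leibniz_eventually) auto
qed

text \<open>For a natural exponent the complex \<open>powr\<close> of the nonzero base is an
  ordinary power, so all terms are real and real summability carries over through
  \<open>of_real\<close>.\<close>

lemma alt_harm_dirichlet_of_nat_tendsto:
  assumes "s > 0"
  shows "(\<lambda>N. \<Sum>n=1..N. (-1) ^ (n + 1) * harm n ^ k / of_nat n ^ s)
           \<longlonglongrightarrow> alt_harm_dirichlet k (of_nat s)"
proof -
  define f :: "nat \<Rightarrow> complex" where "f = (\<lambda>n. (-1) ^ (n + 1) * harm n ^ k / of_nat n ^ s)"
  have f_real: "f (Suc n) = of_real ((-1) ^ n * (harm (Suc n) ^ k / real (Suc n) ^ s))" for n
    by (simp add: f_def of_real_harm)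
  have "summable (\<lambda>n. f (Suc n))"
    unfolding f_real by (intro summable_of_real summable_alternating_harm_power assms)
  then have "(\<lambda>N. \<Sum>n<N. f (Suc n)) \<longlonglongrightarrow> (\<Sum>n. f (Suc n))"
    by (rule summable_LIMSEQ)
  moreover have "(\<Sum>n<N. f (Suc n)) = (\<Sum>n=1..N. f n)" for N
    by (rule sum.reindex_bij_witness [of _ "\<lambda>n. n - 1" Suc]) auto
  moreover have "f (Suc n) = (-1) ^ (Suc n + 1) * harm (Suc n) ^ k
                     * of_nat (Suc n) powr (- of_nat s)" for n
    unfolding f_def by (simp add: powr_minus powr_nat' divide_inverse del: of_nat_Suc)
  ultimately show ?thesis
    unfolding alt_harm_dirichlet_def f_def by simp
qed

lemma alternating_harm_power_sum:
  assumes "m > 0"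
  shows "(\<Sum>n=1..N. (-1) ^ (n + 1) * (harm n :: 'a :: real_normed_field) ^ m)
           = (-1) ^ (N + 1) / 2 * harm (N + 1) ^ m
             + (\<Sum>k=0..m-1. of_nat (m choose k) * ((-1) ^ (m - k - 1) / 2)
                  * (\<Sum>n=1..N+1. (-1) ^ (n + 1) * harm n ^ k / of_nat n ^ (m - k)))"
proof -
  define S :: "nat \<Rightarrow> 'a" where "S = (\<lambda>N. \<Sum>n=1..N. (-1) ^ (n + 1) * harm n ^ m)"
  define J :: "nat \<Rightarrow> 'a"
    where "J = (\<lambda>k. \<Sum>n=1..N+1. (-1) ^ (n + 1) * harm n ^ k / of_nat n ^ (m - k))"
  define T where "T = (\<Sum>k=0..m-1. of_nat (m choose k) * (-1) ^ (m - k) * J k)"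
  \<comment> \<open>The term \<open>k = m\<close> of the binomial expansion is split off as
    \<open>harm n ^ m\<close>; the others have a positive power of \<open>n\<close> in the
    denominator.\<close>
  have expand: "(-1) ^ (n + 1) * harm (n - 1) ^ m = (-1) ^ (n + 1) * harm n ^ m
      + (\<Sum>k=0..m-1. of_nat (m choose k) * (-1) ^ (m - k)
           * ((-1) ^ (n + 1) * harm n ^ k / (of_nat n :: 'a) ^ (m - k)))" if "n \<ge> 1" for n
  proof -
    have "harm (n - 1) = harm n + - (1 / of_nat n :: 'a)"
      using that by (cases n) (auto simp: harm_Suc inverse_eq_divide)
    then have "harm (n - 1) ^ m = (\<Sum>k\<le>m. of_nat (m choose k) * harm n ^ k * (- (1 / of_nat n :: 'a)) ^ (m - k))"
      by (simp only: binomial_ring)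
    also have "{..m} = insert m {0..m-1}"
      using assms by auto
    also have "(\<Sum>k\<in>insert m {0..m-1}. of_nat (m choose k) * harm n ^ k * (- (1 / of_nat n :: 'a)) ^ (m - k))
        = harm n ^ m + (\<Sum>k=0..m-1. of_nat (m choose k) * harm n ^ k * (- (1 / of_nat n)) ^ (m - k))"
      using assms by (subst sum.insert) auto
    finally show ?thesis
      by (simp add: distrib_left sum_distrib_left power_minus [of "1 / of_nat n"] power_one_over
                    field_simps)
  qed
  have "(\<Sum>n=1..N+1. (-1) ^ (n + 1) * (harm (n - 1) :: 'a) ^ m) = S (N + 1) + T"
    unfolding S_def T_def J_def sum_distrib_left
    by (subst sum.swap, subst sum.distrib [symmetric], rule sum.cong [OF refl], rule expand) simp
  moreover have "(\<Sum>n=1..N+1. (-1) ^ (n + 1) * (harm (n - 1) :: 'a) ^ m) = - S N"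
  proof -
    \<comment> \<open>Replacing \<open>n\<close> by \<open>n + 1\<close> flips the sign, and the new
      term at 0 vanishes because \<open>harm 0 = 0\<close> and \<open>m > 0\<close>.\<close>
    have "(\<Sum>n=1..N+1. (-1) ^ (n + 1) * (harm (n - 1) :: 'a) ^ m)
            = (\<Sum>n=0..N. - ((-1) ^ (n + 1) * harm n ^ m))"
      by (rule sum.reindex_bij_witness [of _ Suc "\<lambda>n. n - 1"])  auto
    also have "\<dots> = - S N"
      using assms by (simp add: S_def sum_negf sum.atLeast_Suc_atMost zero_power harm_def)
    finally show ?thesis .
  qed
  moreover have "S (N + 1) = S N + (-1) ^ N * harm (N + 1) ^ m"
    by (simp add: S_def)
  ultimately have solve: "S N + (-1) ^ N * harm (N + 1) ^ m + T = - S N"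
    by simp
  \<comment> \<open>The field \<open>'a\<close> carries no order, so \<open>2 * S N\<close> is
    isolated by hand: the two sides of its formula differ by the difference of the two sides of
    \<open>solve\<close>, which is 0.\<close>
  have "2 * S N - ((-1) ^ (N + 1) * harm (N + 1) ^ m - T)
          = (S N + (-1) ^ N * harm (N + 1) ^ m + T) - (- S N)"
    by (simp add: algebra_simps)
  then have "2 * S N = (-1) ^ (N + 1) * harm (N + 1) ^ m - T"
    by (simp only: solve diff_self right_minus_eq)
  then have "S N = ((-1) ^ (N + 1) * harm (N + 1) ^ m - T) / 2"
    by (simp only: eq_divide_eq mult.commute) simp
  also have "\<dots> = (-1) ^ (N + 1) / 2 * harm (N + 1) ^ m + (- T / 2)"
    by (simp add: diff_divide_distrib)
  also have "- T / 2 = (\<Sum>k=0..m-1. of_nat (m choose k) * ((-1) ^ (m - k - 1) / 2) * J k)"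
    unfolding T_def sum_negf [symmetric] sum_divide_distrib
  proof (rule sum.cong [OF refl])
    fix k assume "k \<in> {0..m-1}"
    \<comment> \<open>Since \<open>k < m\<close>, no subtraction is truncated, and lowering the
      exponent by one absorbs the minus sign of \<open>- T\<close>.\<close>
    then have "m - k = Suc (m - k - 1)"
      using assms by auto
    then have "(-1 :: 'a) ^ (m - k) = - ((-1) ^ (m - k - 1))"
      by (metis power_Suc mult_minus1)
    then show "- (of_nat (m choose k) * (-1) ^ (m - k) * J k) / 2
        = of_nat (m choose k) * ((-1) ^ (m - k - 1) / 2) * J k"
      by simp
  qed
  finally show ?thesis
    unfolding S_def J_def .
qed

theorem theorem12:
  fixes m :: nat
  assumes "m > 0"
  shows "(\<lambda>N::nat. (\<Sum>n=1..N. (-1) ^ (n + 1) * (harm n :: complex) ^ m)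
            - ((-1) ^ (N + 1) / 2 * harm (N + 1) ^ m
               + (\<Sum>k=0..m-1. of_nat (m choose k) * ((-1) ^ (m - k - 1) / 2)
                                * alt_harm_dirichlet k (of_nat (m - k)))))
         \<in> o(\<lambda>_. 1 :: complex)"
proof -
  define P :: "nat \<Rightarrow> nat \<Rightarrow> complex"
    where "P = (\<lambda>k N. \<Sum>n=1..N. (-1) ^ (n + 1) * harm n ^ k / of_nat n ^ (m - k))"
  have P_lim: "(\<lambda>N. P k (N + 1)) \<longlonglongrightarrow> alt_harm_dirichlet k (of_nat (m - k))"
    if "k \<in> {0..m-1}" for k
    \<comment> \<open>Here \<open>k < m\<close> makes the exponent \<open>m - k\<close> positive, as
      the convergence result requires.\<close>
    unfolding P_def using that assms
    by (intro LIMSEQ_ignore_initial_segment alt_harm_dirichlet_of_nat_tendsto) auto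
  have "(\<lambda>N. (\<Sum>k=0..m-1. of_nat (m choose k) * ((-1) ^ (m - k - 1) / 2) * P k (N + 1))
          - (\<Sum>k=0..m-1. of_nat (m choose k) * ((-1) ^ (m - k - 1) / 2)
               * alt_harm_dirichlet k (of_nat (m - k)))) \<longlonglongrightarrow> 0"
    by (intro LIM_zero tendsto_sum tendsto_mult_left P_lim)
  \<comment> \<open>After the exact identity is inserted, the terms with
    \<open>harm (N + 1) ^ m\<close> cancel, leaving the difference just shown to tend to 0.\<close>
  then show ?thesis
    unfolding alternating_harm_power_sum [OF assms] P_def by (intro smalloI_tendsto) simp_all
qed

end
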